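(* Let $Mod(\mathcal{L}_A)$ be the class of all models of $\mathsf{PA}$ (without any restriction on domains). Let $P:\mathcal{SL}_A\to[0,1]$ be a function satisfying: (i) if $Mod(\mathcal{L}_A)\vDash\varphi$, then $P(\varphi)=1$; (ii) if $Mod(\mathcal{L}_A)\vDash\neg(\varphi\land\psi)$, then $P(\varphi\lor\psi)=P(\varphi)+P(\psi)$; (G3) $P(\exists x\,\psi(x))=\sup\{P(\bigvee_{i<n}\psi(\underline{i}))\mid n\in\omega\}$ for every sentence $\exists x\,\psi(x)\in\mathcal{SL}_A$. Then for all $\varphi\in\mathcal{SL}_A$, $P(\varphi)=V_{\mathbb{N}}(\varphi)$, where $V_{\mathbb{N}}(\varphi)=1$ if $\mathbb{N}\vDash\varphi$ and $V_{\mathbb{N}}(\varphi)=0$ otherwise.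
   Context: $\mathcal{L}_A$ is the first-order language of arithmetic with symbols $0,S,+,\times,x^y,<$, and $\mathcal{SL}_A$ is its set of sentences. $\underline{n}:=S^n(0)$ is the $n$-th numeral. $\mathsf{PA}$ is first-order Peano arithmetic in this language (with the usual defining axioms for exponentiation and $<$). $\mathbb{N}$ is the standard model with domain $\omega$. $Mod(\mathcal{L}_A)\vDash\varphi$ means that every model of $\mathsf{PA}$ satisfies $\varphi$. *)

theory Defs
  imports Complex_Main "HOL-Library.Countable_Set"
begin

section \<open>The language of arithmetic\<close>

datatype tm =
    Var nat
  | Zero
  | Succ tm
  | Plus tm tm
  | Times tm tm
  | Power tm tm

datatype fm =
    Eq tm tm
  | Less tm tm
  | Neg fm
  | And fm fm
  | Or fm fm
  | Imp fm fm
  | Forall nat fm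
  | Exists nat fm

primrec vars_tm :: "tm \<Rightarrow> nat set" where
  "vars_tm (Var x) = {x}"
| "vars_tm Zero = {}"
| "vars_tm (Succ t) = vars_tm t"
| "vars_tm (Plus s t) = vars_tm s \<union> vars_tm t"
| "vars_tm (Times s t) = vars_tm s \<union> vars_tm t"
| "vars_tm (Power s t) = vars_tm s \<union> vars_tm t"

primrec free_vars :: "fm \<Rightarrow> nat set" where
  "free_vars (Eq s t) = vars_tm s \<union> vars_tm t"
| "free_vars (Less s t) = vars_tm s \<union> vars_tm t"
| "free_vars (Neg \<phi>) = free_vars \<phi>"
| "free_vars (And \<phi> \<psi>) = free_vars \<phi> \<union> free_vars \<psi>"
| "free_vars (Or \<phi> \<psi>) = free_vars \<phi> \<union> free_vars \<psi>"
| "free_vars (Imp \<phi> \<psi>) = free_vars \<phi> \<union> free_vars \<psi>"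
| "free_vars (Forall x \<phi>) = free_vars \<phi> - {x}"
| "free_vars (Exists x \<phi>) = free_vars \<phi> - {x}"

definition sentences :: "fm set" where
  "sentences = {\<phi>. free_vars \<phi> = {}}"

primrec numeral_tm :: "nat \<Rightarrow> tm" where
  "numeral_tm 0 = Zero"
| "numeral_tm (Suc n) = Succ (numeral_tm n)"

primrec subst_tm :: "tm \<Rightarrow> nat \<Rightarrow> tm \<Rightarrow> tm" where
  "subst_tm (Var y) x u = (if y = x then u else Var y)"
| "subst_tm Zero x u = Zero"
| "subst_tm (Succ t) x u = Succ (subst_tm t x u)"
| "subst_tm (Plus s t) x u = Plus (subst_tm s x u) (subst_tm t x u)"
| "subst_tm (Times s t) x u = Times (subst_tm s x u) (subst_tm t x u)"
| "subst_tm (Power s t) x u = Power (subst_tm s x u) (subst_tm t x u)"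

text \<open>
  Bound variables are not renamed. The result is nevertheless the usual capture-avoiding
  substitution whenever \<open>vars_tm u \<subseteq> {x}\<close>: below a quantifier binding \<open>x\<close> nothing is replaced,
  and no other quantifier can capture a variable of \<open>u\<close>. Only such \<open>u\<close> are used
  (numerals and \<open>Succ (Var x)\<close>); see \<open>sat_subst\<close> below.
\<close>

primrec subst :: "fm \<Rightarrow> nat \<Rightarrow> tm \<Rightarrow> fm" where
  "subst (Eq s t) x u = Eq (subst_tm s x u) (subst_tm t x u)"
| "subst (Less s t) x u = Less (subst_tm s x u) (subst_tm t x u)"
| "subst (Neg \<phi>) x u = Neg (subst \<phi> x u)"
| "subst (And \<phi> \<psi>) x u = And (subst \<phi> x u) (subst \<psi> x u)"
| "subst (Or \<phi> \<psi>) x u = Or (subst \<phi> x u) (subst \<psi> x u)"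
| "subst (Imp \<phi> \<psi>) x u = Imp (subst \<phi> x u) (subst \<psi> x u)"
| "subst (Forall y \<phi>) x u = Forall y (if y = x then \<phi> else subst \<phi> x u)"
| "subst (Exists y \<phi>) x u = Exists y (if y = x then \<phi> else subst \<phi> x u)"

text \<open>
  \<open>disj_below n \<psi>\<close> is the disjunction of the formulas \<open>\<psi> i\<close> for \<open>i < n\<close>; the empty disjunction
  is a false sentence.
\<close>

fun disj_below :: "nat \<Rightarrow> (nat \<Rightarrow> fm) \<Rightarrow> fm" where
  "disj_below 0 \<psi> = Neg (Eq Zero Zero)"
| "disj_below (Suc 0) \<psi> = \<psi> 0"
| "disj_below (Suc (Suc n)) \<psi> = Or (disj_below (Suc n) \<psi>) (\<psi> (Suc n))"


section \<open>Structures and satisfaction\<close>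

text \<open>
  The domain of a structure is a set of elements of the type \<open>'u\<close>, and the function symbols
  are only required to be closed on this set.
\<close>

record 'u arith_struct =
  dom_of :: "'u set"
  zero_of :: 'u
  succ_of :: "'u \<Rightarrow> 'u"
  plus_of :: "'u \<Rightarrow> 'u \<Rightarrow> 'u"
  times_of :: "'u \<Rightarrow> 'u \<Rightarrow> 'u"
  power_of :: "'u \<Rightarrow> 'u \<Rightarrow> 'u"
  less_of :: "'u \<Rightarrow> 'u \<Rightarrow> bool"

definition is_struct :: "'u arith_struct \<Rightarrow> bool" where
  "is_struct M \<longleftrightarrow>
     zero_of M \<in> dom_of M \<and>
     (\<forall>a\<in>dom_of M. succ_of M a \<in> dom_of M) \<and>
     (\<forall>a\<in>dom_of M. \<forall>b\<in>dom_of M. plus_of M a b \<in> dom_of M) \<and>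
     (\<forall>a\<in>dom_of M. \<forall>b\<in>dom_of M. times_of M a b \<in> dom_of M) \<and>
     (\<forall>a\<in>dom_of M. \<forall>b\<in>dom_of M. power_of M a b \<in> dom_of M)"

primrec val :: "'u arith_struct \<Rightarrow> (nat \<Rightarrow> 'u) \<Rightarrow> tm \<Rightarrow> 'u" where
  "val M e (Var x) = e x"
| "val M e Zero = zero_of M"
| "val M e (Succ t) = succ_of M (val M e t)"
| "val M e (Plus s t) = plus_of M (val M e s) (val M e t)"
| "val M e (Times s t) = times_of M (val M e s) (val M e t)"
| "val M e (Power s t) = power_of M (val M e s) (val M e t)"

primrec sat :: "'u arith_struct \<Rightarrow> (nat \<Rightarrow> 'u) \<Rightarrow> fm \<Rightarrow> bool" where
  "sat M e (Eq s t) \<longleftrightarrow> val M e s = val M e t"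
| "sat M e (Less s t) \<longleftrightarrow> less_of M (val M e s) (val M e t)"
| "sat M e (Neg \<phi>) \<longleftrightarrow> \<not> sat M e \<phi>"
| "sat M e (And \<phi> \<psi>) \<longleftrightarrow> sat M e \<phi> \<and> sat M e \<psi>"
| "sat M e (Or \<phi> \<psi>) \<longleftrightarrow> sat M e \<phi> \<or> sat M e \<psi>"
| "sat M e (Imp \<phi> \<psi>) \<longleftrightarrow> (sat M e \<phi> \<longrightarrow> sat M e \<psi>)"
| "sat M e (Forall x \<phi>) \<longleftrightarrow> (\<forall>a\<in>dom_of M. sat M (e(x := a)) \<phi>)"
| "sat M e (Exists x \<phi>) \<longleftrightarrow> (\<exists>a\<in>dom_of M. sat M (e(x := a)) \<phi>)"

text \<open>A formula with free variables counts as its universal closure.\<close>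

definition models :: "'u arith_struct \<Rightarrow> fm \<Rightarrow> bool" (infix "\<Turnstile>" 50) where
  "M \<Turnstile> \<phi> \<longleftrightarrow> (\<forall>e. range e \<subseteq> dom_of M \<longrightarrow> sat M e \<phi>)"

definition standard_model :: "nat arith_struct" where
  "standard_model =
     \<lparr>dom_of = UNIV, zero_of = 0, succ_of = Suc, plus_of = (+), times_of = (*),
      power_of = (^), less_of = (<)\<rparr>"

definition truth_value :: "'u arith_struct \<Rightarrow> fm \<Rightarrow> real" where
  "truth_value M \<phi> = (if M \<Turnstile> \<phi> then 1 else 0)"


section \<open>Peano arithmetic\<close>

definition induction_axiom :: "nat \<Rightarrow> fm \<Rightarrow> fm" where
  "induction_axiom x \<phi> =
     Imp (And (subst \<phi> x Zero) (Forall x (Imp \<phi> (subst \<phi> x (Succ (Var x)))))) (Forall x \<phi>)"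

text \<open>
  Free variables in the axioms are implicitly universally quantified; in particular
  the induction formulas may contain parameters.
\<close>

definition PA :: "fm set" where
  "PA =
     (let x = Var 0; y = Var 1; z = Var 2 in
      {Neg (Eq (Succ x) Zero),
       Imp (Eq (Succ x) (Succ y)) (Eq x y),
       Eq (Plus x Zero) x,
       Eq (Plus x (Succ y)) (Succ (Plus x y)),
       Eq (Times x Zero) Zero,
       Eq (Times x (Succ y)) (Plus (Times x y) x),
       Eq (Power x Zero) (Succ Zero),
       Eq (Power x (Succ y)) (Times (Power x y) x),
       Imp (Less x y) (Exists 2 (Eq (Plus z (Succ x)) y)),
       Imp (Exists 2 (Eq (Plus z (Succ x)) y)) (Less x y)})
     \<union> {induction_axiom x \<phi> | x \<phi>. True}"

definition PA_model :: "'u arith_struct \<Rightarrow> bool" where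
  "PA_model M \<longleftrightarrow> is_struct M \<and> (\<forall>\<alpha>\<in>PA. M \<Turnstile> \<alpha>)"

text \<open>
  HOL has no quantification over types, so the class of all models of \<open>PA\<close> is represented by
  those with domain inside a type \<open>'u\<close>. By the theorem \<open>PA_valid_iff\<close> below, validity does
  not depend on \<open>'u\<close> as long as \<open>'u\<close> is infinite, and by \<open>PA_valid_nat_imp\<close> validity over \<open>nat\<close>
  already implies truth in all models of \<open>PA\<close> over any type.
\<close>

definition PA_valid :: "'u itself \<Rightarrow> fm \<Rightarrow> bool" where
  "PA_valid _ \<phi> \<longleftrightarrow> (\<forall>M :: 'u arith_struct. PA_model M \<longrightarrow> M \<Turnstile> \<phi>)"


section \<open>Adequacy of the definitions\<close>

lemma val_cong: "(\<And>x. x \<in> vars_tm t \<Longrightarrow> e x = e' x) \<Longrightarrow> val M e t = val M e' t"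
  by (induction t) auto

lemma sat_cong: "(\<And>x. x \<in> free_vars \<phi> \<Longrightarrow> e x = e' x) \<Longrightarrow> sat M e \<phi> \<longleftrightarrow> sat M e' \<phi>"
proof (induction \<phi> arbitrary: e e')
  case (Eq s t)
  then show ?case using val_cong[of s e e' M] val_cong[of t e e' M] by simp
next
  case (Less s t)
  then show ?case using val_cong[of s e e' M] val_cong[of t e e' M] by simp
next
  case (Neg \<phi>)
  then show ?case by (metis free_vars.simps(3) sat.simps(3))
next
  case (And \<phi> \<psi>)
  then show ?case by (metis UnCI free_vars.simps(4) sat.simps(4))
next
  case (Or \<phi> \<psi>)
  then show ?case by (metis UnCI free_vars.simps(5) sat.simps(5))
next
  case (Imp \<phi> \<psi>)
  then show ?case by (metis UnCI free_vars.simps(6) sat.simps(6))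
next
  case (Forall x \<phi>)
  have "sat M (e(x := a)) \<phi> = sat M (e'(x := a)) \<phi>" for a
    using Forall.prems by (intro Forall.IH) auto
  then show ?case by simp
next
  case (Exists x \<phi>)
  have "sat M (e(x := a)) \<phi> = sat M (e'(x := a)) \<phi>" for a
    using Exists.prems by (intro Exists.IH) auto
  then show ?case by simp
qed

lemma finite_vars_tm: "finite (vars_tm t)"
  by (induction t) auto

lemma finite_free_vars: "finite (free_vars \<phi>)"
  by (induction \<phi>) (auto simp: finite_vars_tm)

lemma val_subst: "val M e (subst_tm t x u) = val M (e(x := val M e u)) t"
  by (induction t) auto

lemma sat_subst:
  assumes "vars_tm u \<subseteq> {x}"
  shows "sat M e (subst \<phi> x u) \<longleftrightarrow> sat M (e(x := val M e u)) \<phi>"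
proof (induction \<phi> arbitrary: e)
  case (Forall y \<phi>)
  have "val M (e(y := a)) u = val M e u" if "y \<noteq> x" for a
    using assms that by (intro val_cong) auto
  then show ?case using Forall.IH by (cases "y = x") (simp_all add: fun_upd_twist del: fun_upd_apply)
next
  case (Exists y \<phi>)
  have "val M (e(y := a)) u = val M e u" if "y \<noteq> x" for a
    using assms that by (intro val_cong) auto
  then show ?case using Exists.IH by (cases "y = x") (simp_all add: fun_upd_twist del: fun_upd_apply)
qed (auto simp: val_subst)

lemma PA_model_standard_model: "PA_model standard_model"
proof -
  let ?N = standard_model
  have ind: "sat ?N e (induction_axiom x \<phi>)" for e x \<phi>
  proof -
    have "sat ?N (e(x := n)) \<phi>"
      if "sat ?N (e(x := 0)) \<phi>"
        and "\<And>n. sat ?N (e(x := n)) \<phi> \<Longrightarrow> sat ?N (e(x := Suc n)) \<phi>" for n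
      using that by (induction n) auto
    then show ?thesis
      by (auto simp: induction_axiom_def sat_subst standard_model_def)
  qed
  have less: "(\<exists>c. c + Suc a = b) \<longleftrightarrow> a < b" for a b :: nat
    by (metis add.commute less_iff_Suc_add add_Suc_right)
  show ?thesis
    using ind unfolding PA_model_def is_struct_def models_def PA_def
    by (auto simp: Let_def standard_model_def less[symmetric])
qed

subsection \<open>Truth is preserved under isomorphism\<close>

definition image_struct :: "('u \<Rightarrow> 'v) \<Rightarrow> 'u arith_struct \<Rightarrow> 'v arith_struct" where
  "image_struct g M =
     (let h = inv_into (dom_of M) g in
      \<lparr>dom_of = g ` dom_of M, zero_of = g (zero_of M), succ_of = (\<lambda>a. g (succ_of M (h a))),
       plus_of = (\<lambda>a b. g (plus_of M (h a) (h b))),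
       times_of = (\<lambda>a b. g (times_of M (h a) (h b))),
       power_of = (\<lambda>a b. g (power_of M (h a) (h b))),
       less_of = (\<lambda>a b. less_of M (h a) (h b))\<rparr>)"

lemma val_in_dom: "is_struct M \<Longrightarrow> range e \<subseteq> dom_of M \<Longrightarrow> val M e t \<in> dom_of M"
  by (induction t) (auto simp: is_struct_def)

lemma is_struct_image: "is_struct M \<Longrightarrow> inj_on g (dom_of M) \<Longrightarrow> is_struct (image_struct g M)"
  by (auto simp: is_struct_def image_struct_def Let_def)

lemma val_image:
  assumes "is_struct M" "inj_on g (dom_of M)" "range e \<subseteq> dom_of M"
  shows "val (image_struct g M) (g \<circ> e) t = g (val M e t)"
  by (induction t) (use val_in_dom[OF assms(1,3)] assms(2) in \<open>auto simp: image_struct_def Let_def\<close>)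

lemma sat_image:
  assumes "is_struct M" "inj_on g (dom_of M)"
  shows "range e \<subseteq> dom_of M \<Longrightarrow> sat (image_struct g M) (g \<circ> e) \<phi> \<longleftrightarrow> sat M e \<phi>"
proof (induction \<phi> arbitrary: e)
  case (Eq s t)
  then show ?case
    using val_image[OF assms Eq.prems] val_in_dom[OF assms(1) Eq.prems] assms(2)
    by (simp add: inj_on_eq_iff del: comp_apply)
next
  case (Less s t)
  have "less_of (image_struct g M) (g a) (g b) \<longleftrightarrow> less_of M a b"
    if "a \<in> dom_of M" "b \<in> dom_of M" for a b
    using that assms(2) by (simp add: image_struct_def Let_def)
  then show ?case
    using val_image[OF assms Less.prems] val_in_dom[OF assms(1) Less.prems]
    by (simp del: comp_apply)
next
  case (Forall x \<phi>)
  have "sat (image_struct g M) ((g \<circ> e)(x := g a)) \<phi> = sat M (e(x := a)) \<phi>"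
    if "a \<in> dom_of M" for a
  proof -
    have "range (e(x := a)) \<subseteq> dom_of M" using Forall.prems that by auto
    from Forall.IH[OF this] show ?thesis by (simp only: fun_upd_comp)
  qed
  moreover have "dom_of (image_struct g M) = g ` dom_of M" by (simp add: image_struct_def Let_def)
  ultimately show ?case by (simp del: comp_apply)
next
  case (Exists x \<phi>)
  have "sat (image_struct g M) ((g \<circ> e)(x := g a)) \<phi> = sat M (e(x := a)) \<phi>"
    if "a \<in> dom_of M" for a
  proof -
    have "range (e(x := a)) \<subseteq> dom_of M" using Exists.prems that by auto
    from Exists.IH[OF this] show ?thesis by (simp only: fun_upd_comp)
  qed
  moreover have "dom_of (image_struct g M) = g ` dom_of M" by (simp add: image_struct_def Let_def)
  ultimately show ?case by (simp del: comp_apply)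
qed auto

lemma models_image:
  assumes "is_struct M" "inj_on g (dom_of M)"
  shows "image_struct g M \<Turnstile> \<phi> \<longleftrightarrow> M \<Turnstile> \<phi>"
proof -
  have D: "dom_of (image_struct g M) = g ` dom_of M" by (simp add: image_struct_def Let_def)
  have "sat (image_struct g M) e \<phi>" if "M \<Turnstile> \<phi>" "range e \<subseteq> g ` dom_of M" for e
  proof -
    define e' where "e' = inv_into (dom_of M) g \<circ> e"
    have "range e' \<subseteq> dom_of M" using that(2) by (auto simp: e'_def intro!: inv_into_into)
    moreover have "g \<circ> e' = e" using that(2) by (auto simp: e'_def f_inv_into_f range_subsetD)
    ultimately show ?thesis
      using sat_image[OF assms, of e' \<phi>] that(1) by (simp add: models_def)
  qed
  moreover have "sat M e \<phi>" if "image_struct g M \<Turnstile> \<phi>" "range e \<subseteq> dom_of M" for e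
  proof -
    have "range (g \<circ> e) \<subseteq> g ` dom_of M" using that(2) by auto
    then show ?thesis
      using sat_image[OF assms, of e \<phi>] that by (simp add: models_def D)
  qed
  ultimately show ?thesis by (auto simp: models_def D)
qed

lemma PA_model_image: "PA_model M \<Longrightarrow> inj_on g (dom_of M) \<Longrightarrow> PA_model (image_struct g M)"
  by (simp add: PA_model_def is_struct_image models_image)

subsection \<open>Downward Loewenheim-Skolem\<close>

instance tm :: countable by countable_datatype
instance fm :: countable by countable_datatype

lemma countable_hull:
  fixes M :: "'u arith_struct" and e0 :: "nat \<Rightarrow> 'u"
  assumes M: "is_struct M" and e0: "range e0 \<subseteq> dom_of M"
  obtains C where "countable C" "range e0 \<subseteq> C" "C \<subseteq> dom_of M"
    "\<And>e x \<phi>. range e \<subseteq> C \<Longrightarrow> \<exists>a\<in>dom_of M. sat M (e(x := a)) \<phi> \<Longrightarrow> \<exists>a\<in>C. sat M (e(x := a)) \<phi>"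
proof -
  define z where "z = zero_of M"
  define env where "env l n = (if n < length l then l ! n else z)" for l :: "'u list" and n
  define sk where "sk = (\<lambda>(\<phi>, x, l). if \<exists>a\<in>dom_of M. sat M ((env l)(x := a)) \<phi>
      then SOME a. a \<in> dom_of M \<and> sat M ((env l)(x := a)) \<phi> else z)"
  have z: "z \<in> dom_of M" using M by (simp add: z_def is_struct_def)
  have sk: "sk (\<phi>, x, l) \<in> dom_of M \<and> sat M ((env l)(x := sk (\<phi>, x, l))) \<phi>"
    if "\<exists>a\<in>dom_of M. sat M ((env l)(x := a)) \<phi>" for \<phi> x l
    using someI_ex[of "\<lambda>a. a \<in> dom_of M \<and> sat M ((env l)(x := a)) \<phi>"] that
    by (auto simp: sk_def)
  have sk_dom: "sk p \<in> dom_of M" for p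
    using sk z by (cases p) (auto simp: sk_def)
  define H where "H = rec_nat (insert z (range e0)) (\<lambda>_ X. X \<union> sk ` (UNIV \<times> UNIV \<times> lists X))"
  have H0: "H 0 = insert z (range e0)" by (simp add: H_def)
  have HS: "H (Suc n) = H n \<union> sk ` (UNIV \<times> UNIV \<times> lists (H n))" for n by (simp add: H_def)
  have cnt: "countable (H n)" for n
    by (induction n) (auto simp: H0 HS intro!: countable_SIGMA countable_lists countable_image)
  have sub: "H n \<subseteq> dom_of M" for n
    by (induction n) (use z e0 sk_dom in \<open>auto simp: H0 HS\<close>)
  have mono: "H m \<subseteq> H n" if "m \<le> n" for m n
    using that by (rule lift_Suc_mono_le[rotated]) (auto simp: HS)
  define C where "C = (\<Union>n. H n)"
  have lists: "\<exists>n. set l \<subseteq> H n" if "set l \<subseteq> C" for l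
    using that
  proof (induction l)
    case (Cons a l)
    then obtain m n where "a \<in> H m" "set l \<subseteq> H n" by (auto simp: C_def)
    then have "set (a # l) \<subseteq> H (max m n)"
      using mono[of m "max m n"] mono[of n "max m n"] by auto
    then show ?case ..
  qed simp
  show ?thesis
  proof
    show "countable C" using cnt by (simp add: C_def)
    show "range e0 \<subseteq> C" using H0 by (auto simp: C_def)
    show "C \<subseteq> dom_of M" using sub by (auto simp: C_def)
    fix e x \<phi>
    assume e: "range e \<subseteq> C" and ex: "\<exists>a\<in>dom_of M. sat M (e(x := a)) \<phi>"
    obtain N where N: "\<And>y. y \<in> free_vars \<phi> \<Longrightarrow> y < N"
      using finite_free_vars[of \<phi>] by (metis finite_nat_set_iff_bounded)
    define l where "l = map e [0..<N]"
    have eq: "sat M ((env l)(x := a)) \<phi> \<longleftrightarrow> sat M (e(x := a)) \<phi>" for a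
      by (rule sat_cong) (use N in \<open>auto simp: env_def l_def\<close>)
    have "set l \<subseteq> C" using e by (auto simp: l_def)
    then obtain n where "set l \<subseteq> H n" using lists by blast
    then have "sk (\<phi>, x, l) \<in> H (Suc n)" by (auto simp: HS)
    then have "sk (\<phi>, x, l) \<in> C" by (auto simp: C_def)
    then show "\<exists>a\<in>C. sat M (e(x := a)) \<phi>"
      using sk[of l x \<phi>] ex eq by auto
  qed
qed

lemma val_restrict: "val (M\<lparr>dom_of := C\<rparr>) e t = val M e t"
  by (induction t) auto

lemma sat_restrict:
  assumes sub: "C \<subseteq> dom_of M"
    and wit: "\<And>e x \<phi>. range e \<subseteq> C \<Longrightarrow> \<exists>a\<in>dom_of M. sat M (e(x := a)) \<phi>
      \<Longrightarrow> \<exists>a\<in>C. sat M (e(x := a)) \<phi>"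
  shows "range e \<subseteq> C \<Longrightarrow> sat (M\<lparr>dom_of := C\<rparr>) e \<phi> \<longleftrightarrow> sat M e \<phi>"
proof (induction \<phi> arbitrary: e)
  case (Forall x \<phi>)
  have "sat (M\<lparr>dom_of := C\<rparr>) (e(x := a)) \<phi> = sat M (e(x := a)) \<phi>" if "a \<in> C" for a
    using Forall.prems that by (intro Forall.IH) auto
  then show ?case using wit[OF Forall.prems, of x "Neg \<phi>"] sub by auto
next
  case (Exists x \<phi>)
  have "sat (M\<lparr>dom_of := C\<rparr>) (e(x := a)) \<phi> = sat M (e(x := a)) \<phi>" if "a \<in> C" for a
    using Exists.prems that by (intro Exists.IH) auto
  then show ?case using wit[OF Exists.prems, of x \<phi>] sub by auto
qed (auto simp: val_restrict)

lemma is_struct_restrict: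
  assumes M: "is_struct M" and ne: "a0 \<in> C" and sub: "C \<subseteq> dom_of M"
    and wit: "\<And>e x \<phi>. range e \<subseteq> C \<Longrightarrow> \<exists>a\<in>dom_of M. sat M (e(x := a)) \<phi>
      \<Longrightarrow> \<exists>a\<in>C. sat M (e(x := a)) \<phi>"
  shows "is_struct (M\<lparr>dom_of := C\<rparr>)"
proof -
  have cl: "val M e t \<in> C" if e: "range e \<subseteq> C" for e t
  proof -
    obtain x where x: "x \<notin> vars_tm t"
      using finite_vars_tm[of t] ex_new_if_finite infinite_UNIV_nat by blast
    have v: "val M (e(x := a)) t = val M e t" for a
      by (rule val_cong) (use x in auto)
    have "val M e t \<in> dom_of M" using val_in_dom[OF M] e sub by blast
    then show ?thesis using wit[OF e, of x "Eq (Var x) t"] by (auto simp: v)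
  qed
  have "val M ((\<lambda>_. a)(0 := b)) t \<in> C" if "a \<in> C" "b \<in> C" for a b t
    using that by (intro cl) auto
  note cl2 = this[of _ _ "Zero"] this[of _ _ "Succ (Var 0)"] this[of _ _ "Plus (Var 0) (Var 1)"]
    this[of _ _ "Times (Var 0) (Var 1)"] this[of _ _ "Power (Var 0) (Var 1)"]
  show ?thesis
    using cl2 ne by (simp add: is_struct_def)
qed

theorem PA_valid_nat_imp:
  assumes "PA_valid TYPE(nat) \<phi>"
  shows "PA_valid TYPE('u) \<phi>"
  unfolding PA_valid_def models_def
proof (intro allI impI)
  fix M :: "'u arith_struct" and e0 :: "nat \<Rightarrow> 'u"
  assume M: "PA_model M" and e0: "range e0 \<subseteq> dom_of M"
  have st: "is_struct M" using M by (simp add: PA_model_def)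
  obtain C where C: "countable C" "range e0 \<subseteq> C" "C \<subseteq> dom_of M"
    and wit: "\<And>e x \<phi>. range e \<subseteq> C \<Longrightarrow> \<exists>a\<in>dom_of M. sat M (e(x := a)) \<phi>
      \<Longrightarrow> \<exists>a\<in>C. sat M (e(x := a)) \<phi>"
    using countable_hull[OF st e0] by blast
  let ?M = "M\<lparr>dom_of := C\<rparr>"
  have sat: "sat ?M e \<psi> \<longleftrightarrow> sat M e \<psi>" if "range e \<subseteq> C" for e \<psi>
    using sat_restrict[OF C(3) wit] that by blast
  have "is_struct ?M" by (rule is_struct_restrict[OF st _ C(3) wit]) (use C(2) in auto)
  moreover have "?M \<Turnstile> \<psi>" if "M \<Turnstile> \<psi>" for \<psi>
    using that sat C(3) by (auto simp: models_def)
  ultimately have "PA_model ?M" using M by (simp add: PA_model_def)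
  then have "PA_model (image_struct (to_nat_on C) ?M)"
    by (rule PA_model_image) (simp add: C(1) inj_on_to_nat_on)
  then have "image_struct (to_nat_on C) ?M \<Turnstile> \<phi>"
    using assms by (simp add: PA_valid_def)
  then have "?M \<Turnstile> \<phi>"
    using models_image[OF \<open>is_struct ?M\<close>, of "to_nat_on C" \<phi>] C(1) by (simp add: inj_on_to_nat_on)
  then show "sat M e0 \<phi>" using sat[OF C(2)] C(2) by (auto simp: models_def)
qed

theorem PA_valid_iff:
  assumes "infinite (UNIV :: 'u set)"
  shows "PA_valid TYPE('u) \<phi> \<longleftrightarrow> PA_valid TYPE(nat) \<phi>"
proof
  assume valid: "PA_valid TYPE('u) \<phi>"
  obtain g :: "nat \<Rightarrow> 'u" where g: "inj g"
    using infinite_countable_subset[OF assms] by blast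
  show "PA_valid TYPE(nat) \<phi>"
    unfolding PA_valid_def
  proof (intro allI impI)
    fix M :: "nat arith_struct"
    assume M: "PA_model M"
    have inj: "inj_on g (dom_of M)" using g inj_on_subset by blast
    have "image_struct g M \<Turnstile> \<phi>"
      using valid PA_model_image[OF M inj] by (simp add: PA_valid_def)
    then show "M \<Turnstile> \<phi>" using models_image[OF _ inj] M by (simp add: PA_model_def)
  qed
qed (rule PA_valid_nat_imp)

end

theory Submission
  imports Defs
begin

text \<open>
  Such a \<open>P\<close> is a finitely additive probability that gives probability \<open>1\<close> to whatever
  holds in all models of \<open>PA\<close>, and the quantifier clause forces it to treat \<open>Exists x\<close> as ranging over the
  standard numbers. This pins \<open>P\<close> down by induction on the complexity of sentences.

  An atomic sentence is decided in the same way by every model of \<open>PA\<close>: the recursion equations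
  evaluate a closed term to the numeral of its standard value (\<open>val_closed\<close>), and equality and
  order between numerals are absolute (\<open>standard_num_eq_iff\<close>, \<open>less_standard_num_iff\<close>). So \<open>P\<close>
  gives it its truth value. For connectives, the sentences of probability \<open>1\<close> are closed under
  consequence from two premises (\<open>prob_consequence\<close>), and a compound sentence or its negation
  follows from the components or their negations. For \<open>Exists x \<psi>\<close>, the numerical instances have
  their truth values by the induction hypothesis. One true instance already gives a disjunction of
  probability \<open>1\<close>. If all are false, subadditivity makes every finite disjunction null, and so
  is their supremum. A universal sentence is the negation of an existential one.

  In particular \<open>P\<close> never sees nonstandard witnesses: a sentence \<open>Exists x \<psi>\<close> that is
  false in the standard model but consistent with \<open>PA\<close> gets probability \<open>0\<close>.
\<close>

section \<open>Standard elements of models of arithmetic\<close>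

lemma sat_PA_axiom:
  assumes "PA_model M" "\<alpha> \<in> PA" "range e \<subseteq> dom_of M"
  shows "sat M e \<alpha>"
  using assms by (auto simp: PA_model_def models_def)

primrec standard_num :: "'u arith_struct \<Rightarrow> nat \<Rightarrow> 'u" where
  "standard_num M 0 = zero_of M"
| "standard_num M (Suc n) = succ_of M (standard_num M n)"

lemma val_numeral_tm: "val M e (numeral_tm n) = standard_num M n"
  by (induction n) auto

lemma standard_num_standard_model: "standard_num standard_model n = n"
  by (induction n) (auto simp: standard_model_def)

context
  fixes M :: "'u arith_struct"
  assumes M: "PA_model M"
begin

lemma struct: "is_struct M"
  using M by (simp add: PA_model_def)

lemma standard_num_in_dom: "standard_num M n \<in> dom_of M"
  using struct by (induction n) (auto simp: is_struct_def)

lemma PA_axioms_unary: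
  assumes a: "a \<in> dom_of M"
  shows succ_neq_zero: "succ_of M a \<noteq> zero_of M"
    and plus_zero: "plus_of M a (zero_of M) = a"
    and times_zero: "times_of M a (zero_of M) = zero_of M"
    and power_zero: "power_of M a (zero_of M) = succ_of M (zero_of M)"
proof -
  have "range (\<lambda>_::nat. a) \<subseteq> dom_of M"
    using a by auto
  note ax = sat_PA_axiom[OF M _ this]
  show "succ_of M a \<noteq> zero_of M"
    using ax[of "Neg (Eq (Succ (Var 0)) Zero)"] by (simp add: PA_def Let_def)
  show "plus_of M a (zero_of M) = a"
    using ax[of "Eq (Plus (Var 0) Zero) (Var 0)"] by (simp add: PA_def Let_def)
  show "times_of M a (zero_of M) = zero_of M"
    using ax[of "Eq (Times (Var 0) Zero) Zero"] by (simp add: PA_def Let_def)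
  show "power_of M a (zero_of M) = succ_of M (zero_of M)"
    using ax[of "Eq (Power (Var 0) Zero) (Succ Zero)"] by (simp add: PA_def Let_def)
qed

lemma PA_axioms_binary:
  assumes a: "a \<in> dom_of M" and b: "b \<in> dom_of M"
  shows succ_inject: "succ_of M a = succ_of M b \<Longrightarrow> a = b"
    and plus_succ: "plus_of M a (succ_of M b) = succ_of M (plus_of M a b)"
    and times_succ: "times_of M a (succ_of M b) = plus_of M (times_of M a b) a"
    and power_succ: "power_of M a (succ_of M b) = times_of M (power_of M a b) a"
    and less_iff: "less_of M a b \<longleftrightarrow> (\<exists>c\<in>dom_of M. plus_of M c (succ_of M a) = b)"
proof -
  define e where "e = (\<lambda>n::nat. if n = 0 then a else b)"
  have e: "range e \<subseteq> dom_of M" "e 0 = a" "e (Suc 0) = b"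
    using a b by (auto simp: e_def)
  note ax = sat_PA_axiom[OF M _ e(1)]
  show "succ_of M a = succ_of M b \<Longrightarrow> a = b"
    using ax[of "Imp (Eq (Succ (Var 0)) (Succ (Var 1))) (Eq (Var 0) (Var 1))"] e
    by (simp add: PA_def Let_def)
  show "plus_of M a (succ_of M b) = succ_of M (plus_of M a b)"
    using ax[of "Eq (Plus (Var 0) (Succ (Var 1))) (Succ (Plus (Var 0) (Var 1)))"] e
    by (simp add: PA_def Let_def)
  show "times_of M a (succ_of M b) = plus_of M (times_of M a b) a"
    using ax[of "Eq (Times (Var 0) (Succ (Var 1))) (Plus (Times (Var 0) (Var 1)) (Var 0))"] e
    by (simp add: PA_def Let_def)
  show "power_of M a (succ_of M b) = times_of M (power_of M a b) a"
    using ax[of "Eq (Power (Var 0) (Succ (Var 1))) (Times (Power (Var 0) (Var 1)) (Var 0))"] e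
    by (simp add: PA_def Let_def)
  let ?ex = "Exists 2 (Eq (Plus (Var 2) (Succ (Var 0))) (Var 1))"
  show "less_of M a b \<longleftrightarrow> (\<exists>c\<in>dom_of M. plus_of M c (succ_of M a) = b)"
    using ax[of "Imp (Less (Var 0) (Var 1)) ?ex"] ax[of "Imp ?ex (Less (Var 0) (Var 1))"] e
    by (auto simp: PA_def Let_def)
qed

lemma plus_standard_num:
  "plus_of M (standard_num M m) (standard_num M n) = standard_num M (m + n)"
  by (induction n) (simp_all add: plus_zero plus_succ standard_num_in_dom)

lemma times_standard_num:
  "times_of M (standard_num M m) (standard_num M n) = standard_num M (m * n)"
  by (induction n) (simp_all add: times_zero times_succ standard_num_in_dom plus_standard_num add.commute)

lemma power_standard_num:
  "power_of M (standard_num M m) (standard_num M n) = standard_num M (m ^ n)"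
  by (induction n) (simp_all add: power_zero power_succ standard_num_in_dom times_standard_num mult.commute)

lemma standard_num_eq_iff: "standard_num M m = standard_num M n \<longleftrightarrow> m = n"
proof (induction m arbitrary: n)
  case 0
  show ?case
    using succ_neq_zero[OF standard_num_in_dom] by (cases n) (auto dest: sym)
next
  case (Suc m)
  show ?case
    using succ_neq_zero[OF standard_num_in_dom] Suc.IH
      succ_inject[OF standard_num_in_dom standard_num_in_dom]
    by (cases n) auto
qed

text \<open>
  Adding the numeral of \<open>k\<close> is applying the successor \<open>k\<close> times, even to a nonstandard element,
  and cancelling successors on both sides would turn \<open>k > n\<close> into a successor that is zero.
\<close>

lemma plus_standard_num_eq_imp_le:
  assumes "c \<in> dom_of M" "plus_of M c (standard_num M k) = standard_num M n"
  shows "k \<le> n"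
  using assms(2)
proof (induction k arbitrary: n)
  case (Suc k)
  have dom: "plus_of M c (standard_num M k) \<in> dom_of M"
    using struct assms(1) standard_num_in_dom by (auto simp: is_struct_def)
  have eq: "succ_of M (plus_of M c (standard_num M k)) = standard_num M n"
    using Suc.prems plus_succ[OF assms(1) standard_num_in_dom] by simp
  then show ?case
    using succ_neq_zero[OF dom] succ_inject[OF dom standard_num_in_dom] Suc.IH
    by (cases n) auto
qed simp

lemma less_standard_num_iff: "less_of M (standard_num M m) (standard_num M n) \<longleftrightarrow> m < n"
proof
  assume "less_of M (standard_num M m) (standard_num M n)"
  then obtain c where "c \<in> dom_of M" "plus_of M c (standard_num M (Suc m)) = standard_num M n"
    using less_iff[OF standard_num_in_dom standard_num_in_dom] by auto
  then show "m < n"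
    using plus_standard_num_eq_imp_le by fastforce
next
  assume "m < n"
  then have "plus_of M (standard_num M (n - Suc m)) (standard_num M (Suc m)) = standard_num M n"
    using plus_standard_num[of "n - Suc m" "Suc m"] by simp
  then show "less_of M (standard_num M m) (standard_num M n)"
    using less_iff[OF standard_num_in_dom standard_num_in_dom] standard_num_in_dom by auto
qed

lemma val_closed:
  "vars_tm t = {} \<Longrightarrow> val M e t = standard_num M (val standard_model e' t)"
  by (induction t)
    (auto simp: plus_standard_num times_standard_num power_standard_num standard_model_def)

end

section \<open>Truth in the standard model\<close>

text \<open>
  A sentence does not depend on the assignment, so its truth can be evaluated at a single one.
\<close>

definition true_nat :: "fm \<Rightarrow> bool" where
  "true_nat \<phi> \<longleftrightarrow> sat standard_model (\<lambda>_. 0) \<phi>"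

lemma truth_value_sentence:
  assumes "\<phi> \<in> sentences"
  shows "truth_value standard_model \<phi> = of_bool (true_nat \<phi>)"
proof -
  have "sat standard_model e \<phi> \<longleftrightarrow> true_nat \<phi>" for e
    unfolding true_nat_def by (rule sat_cong) (use assms in \<open>auto simp: sentences_def\<close>)
  then show ?thesis
    by (auto simp: truth_value_def models_def standard_model_def)
qed

lemma true_nat_simps:
  "true_nat (Neg \<phi>) \<longleftrightarrow> \<not> true_nat \<phi>"
  "true_nat (And \<phi> \<psi>) \<longleftrightarrow> true_nat \<phi> \<and> true_nat \<psi>"
  "true_nat (Or \<phi> \<psi>) \<longleftrightarrow> true_nat \<phi> \<or> true_nat \<psi>"
  "true_nat (Imp \<phi> \<psi>) \<longleftrightarrow> (true_nat \<phi> \<longrightarrow> true_nat \<psi>)"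
  by (simp_all add: true_nat_def)

lemma vars_numeral_tm: "vars_tm (numeral_tm n) = {}"
  by (induction n) auto

lemma true_nat_Exists: "true_nat (Exists x \<psi>) \<longleftrightarrow> (\<exists>i. true_nat (subst \<psi> x (numeral_tm i)))"
proof -
  have "dom_of standard_model = UNIV"
    by (simp add: standard_model_def)
  then show ?thesis
    by (simp add: true_nat_def sat_subst vars_numeral_tm val_numeral_tm
        standard_num_standard_model)
qed

lemma true_nat_Forall: "true_nat (Forall x \<psi>) \<longleftrightarrow> \<not> true_nat (Exists x (Neg \<psi>))"
  by (simp add: true_nat_def)

text \<open>
  A probability agrees with truth on \<open>\<phi>\<close> when it gives \<open>true_literal \<phi>\<close> probability \<open>1\<close>. This
  covers true and false sentences at once and reduces each connective to one propositional
  tautology about literals.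
\<close>

definition true_literal :: "fm \<Rightarrow> fm" where
  "true_literal \<phi> = (if true_nat \<phi> then \<phi> else Neg \<phi>)"

lemma true_literal_sentence: "\<phi> \<in> sentences \<Longrightarrow> true_literal \<phi> \<in> sentences"
  by (simp add: true_literal_def sentences_def)

lemma PA_valid_true_atom:
  assumes "\<phi> \<in> sentences" "\<phi> = Eq s t \<or> \<phi> = Less s t"
  shows "PA_valid U (true_literal \<phi>)"
proof -
  have closed: "vars_tm s = {}" "vars_tm t = {}"
    using assms by (auto simp: sentences_def)
  have "sat M e (true_literal \<phi>)" if M: "PA_model M" for M :: "'a arith_struct" and e
    using assms(2) val_closed[OF M closed(1), of e "\<lambda>_. 0"]
      val_closed[OF M closed(2), of e "\<lambda>_. 0"]
    by (auto simp: true_literal_def true_nat_def standard_num_eq_iff[OF M]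
        less_standard_num_iff[OF M] standard_model_def)
  then show ?thesis
    by (simp add: PA_valid_def models_def)
qed

section \<open>Instances and disjunctions\<close>

lemma vars_subst_tm: "vars_tm u = {} \<Longrightarrow> vars_tm (subst_tm t x u) = vars_tm t - {x}"
  by (induction t) auto

lemma free_vars_subst: "vars_tm u = {} \<Longrightarrow> free_vars (subst \<phi> x u) = free_vars \<phi> - {x}"
  by (induction \<phi>) (auto simp: vars_subst_tm)

lemma instance_sentence:
  "Exists x \<psi> \<in> sentences \<Longrightarrow> subst \<psi> x (numeral_tm i) \<in> sentences"
  by (simp add: sentences_def free_vars_subst vars_numeral_tm)

lemma disj_below_sentence: "(\<And>i. f i \<in> sentences) \<Longrightarrow> disj_below n f \<in> sentences"
  by (induction n f rule: disj_below.induct) (auto simp: sentences_def)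

lemma sat_disj_below: "sat M e (disj_below n f) \<longleftrightarrow> (\<exists>i<n. sat M e (f i))"
  by (induction n f rule: disj_below.induct) (auto simp: less_Suc_eq)

text \<open>
  Terms do not count, so a numerical instance of \<open>\<psi>\<close> is no more complex than \<open>\<psi>\<close>, and an induction
  on complexity reaches the instances of a quantified sentence.
\<close>

primrec complexity :: "fm \<Rightarrow> nat" where
  "complexity (Eq s t) = 0"
| "complexity (Less s t) = 0"
| "complexity (Neg \<phi>) = Suc (complexity \<phi>)"
| "complexity (And \<phi> \<psi>) = Suc (complexity \<phi> + complexity \<psi>)"
| "complexity (Or \<phi> \<psi>) = Suc (complexity \<phi> + complexity \<psi>)"
| "complexity (Imp \<phi> \<psi>) = Suc (complexity \<phi> + complexity \<psi>)"
| "complexity (Forall x \<phi>) = Suc (complexity \<phi>)"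
| "complexity (Exists x \<phi>) = Suc (complexity \<phi>)"

lemma complexity_subst: "complexity (subst \<phi> x u) = complexity \<phi>"
  by (induction \<phi>) auto

section \<open>Probabilities on sentences\<close>

locale sentence_probability =
  fixes U :: "'u itself" and P :: "fm \<Rightarrow> real"
  assumes prob_range: "\<phi> \<in> sentences \<Longrightarrow> P \<phi> \<in> {0..1}"
    and prob_valid: "\<phi> \<in> sentences \<Longrightarrow> PA_valid U \<phi> \<Longrightarrow> P \<phi> = 1"
    and prob_additive: "\<phi> \<in> sentences \<Longrightarrow> \<psi> \<in> sentences \<Longrightarrow>
      PA_valid U (Neg (And \<phi> \<psi>)) \<Longrightarrow> P (Or \<phi> \<psi>) = P \<phi> + P \<psi>"
begin

lemma prob_Neg: "\<phi> \<in> sentences \<Longrightarrow> P (Neg \<phi>) = 1 - P \<phi>"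
  using prob_valid[of "Or \<phi> (Neg \<phi>)"] prob_additive[of \<phi> "Neg \<phi>"]
  by (simp add: sentences_def PA_valid_def models_def)

text \<open>If \<open>\<phi>\<close> implies \<open>\<psi>\<close>, then \<open>\<phi>\<close> and \<open>Neg \<psi>\<close> exclude each other, so
  \<open>P \<phi> + (1 - P \<psi>)\<close> is the probability of their disjunction.\<close>

lemma prob_mono:
  assumes "\<phi> \<in> sentences" "\<psi> \<in> sentences" "PA_valid U (Imp \<phi> \<psi>)"
  shows "P \<phi> \<le> P \<psi>"
proof -
  have "PA_valid U (Neg (And \<phi> (Neg \<psi>)))"
    using assms(3) by (simp add: PA_valid_def models_def)
  then have "P (Or \<phi> (Neg \<psi>)) = P \<phi> + (1 - P \<psi>)"
    using prob_additive[of \<phi> "Neg \<psi>"] prob_Neg assms by (simp add: sentences_def)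
  then show ?thesis
    using prob_range[of "Or \<phi> (Neg \<psi>)"] assms by (simp add: sentences_def)
qed

lemma prob_Or_le:
  assumes "\<phi> \<in> sentences" "\<psi> \<in> sentences"
  shows "P (Or \<phi> \<psi>) \<le> P \<phi> + P \<psi>"
proof -
  let ?\<psi> = "And (Neg \<phi>) \<psi>"
  have s: "?\<psi> \<in> sentences" "Or \<phi> \<psi> \<in> sentences" "Or \<phi> ?\<psi> \<in> sentences"
    using assms by (auto simp: sentences_def)
  have "P (Or \<phi> \<psi>) \<le> P (Or \<phi> ?\<psi>)"
    by (rule prob_mono) (use s in \<open>auto simp: PA_valid_def models_def\<close>)
  also have "\<dots> = P \<phi> + P ?\<psi>"
    by (rule prob_additive) (use assms s in \<open>auto simp: PA_valid_def models_def\<close>)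
  also have "P ?\<psi> \<le> P \<psi>"
    by (rule prob_mono) (use assms s in \<open>auto simp: PA_valid_def models_def\<close>)
  finally show ?thesis by simp
qed

text \<open>The negation of the conclusion implies that one of two null sentences holds.\<close>

lemma prob_consequence:
  assumes "\<phi> \<in> sentences" "\<psi> \<in> sentences" "\<chi> \<in> sentences"
    and "P \<phi> = 1" "P \<psi> = 1" and "PA_valid U (Imp \<phi> (Imp \<psi> \<chi>))"
  shows "P \<chi> = 1"
proof -
  have "P (Neg \<chi>) \<le> P (Or (Neg \<phi>) (Neg \<psi>))"
    by (rule prob_mono) (use assms in \<open>auto simp: sentences_def PA_valid_def models_def\<close>)
  also have "\<dots> \<le> P (Neg \<phi>) + P (Neg \<psi>)"
    by (rule prob_Or_le) (use assms in \<open>auto simp: sentences_def\<close>)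
  also have "\<dots> = 0"
    using assms by (simp add: prob_Neg)
  finally show ?thesis
    using prob_Neg[of \<chi>] prob_range[of \<chi>] assms by auto
qed

lemma prob_eq_truth_iff:
  assumes "\<phi> \<in> sentences"
  shows "P \<phi> = of_bool (true_nat \<phi>) \<longleftrightarrow> P (true_literal \<phi>) = 1"
  using prob_Neg[OF assms] by (auto simp: true_literal_def)

lemma prob_eq_truth_consequence:
  assumes "\<phi> \<in> sentences" "\<psi> \<in> sentences" "\<chi> \<in> sentences"
    and "P \<phi> = of_bool (true_nat \<phi>)" "P \<psi> = of_bool (true_nat \<psi>)"
    and "PA_valid U (Imp (true_literal \<phi>) (Imp (true_literal \<psi>) (true_literal \<chi>)))"
  shows "P \<chi> = of_bool (true_nat \<chi>)"
  using prob_consequence[OF assms(1-3)[THEN true_literal_sentence]] assms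
  by (simp only: prob_eq_truth_iff)

lemma prob_disj_below_le:
  assumes "\<And>i. f i \<in> sentences"
  shows "P (disj_below n f) \<le> (\<Sum>i<n. P (f i))"
  using assms
proof (induction n f rule: disj_below.induct)
  case (1 f)
  have "P (Eq Zero Zero) = 1"
    by (rule prob_valid) (auto simp: sentences_def PA_valid_def models_def)
  then show ?case
    using prob_Neg[of "Eq Zero Zero"] by (simp add: sentences_def)
next
  case (3 n f)
  have "P (Or (disj_below (Suc n) f) (f (Suc n))) \<le> P (disj_below (Suc n) f) + P (f (Suc n))"
    using 3 by (intro prob_Or_le disj_below_sentence)
  then show ?case
    using 3 by simp
qed simp

end

section \<open>The Gaifman condition and truth\<close>

locale Gaifman_probability = sentence_probability U P
  for U :: "'u itself" and P :: "fm \<Rightarrow> real" +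
  assumes prob_Exists: "Exists x \<psi> \<in> sentences \<Longrightarrow>
      P (Exists x \<psi>) = (SUP n. P (disj_below n (\<lambda>i. subst \<psi> x (numeral_tm i))))"
begin

lemma prob_Exists_eq_truth:
  assumes sent: "Exists x \<psi> \<in> sentences"
    and inst: "\<And>i. P (subst \<psi> x (numeral_tm i)) = of_bool (true_nat (subst \<psi> x (numeral_tm i)))"
  shows "P (Exists x \<psi>) = of_bool (true_nat (Exists x \<psi>))"
proof -
  define f where "f = (\<lambda>i. subst \<psi> x (numeral_tm i))"
  have f: "f i \<in> sentences" for i
    unfolding f_def by (rule instance_sentence[OF sent])
  have D: "disj_below n f \<in> sentences" for n
    by (rule disj_below_sentence[OF f])
  have sup: "P (Exists x \<psi>) = (SUP n. P (disj_below n f))"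
    using prob_Exists[OF sent] by (simp add: f_def)
  show ?thesis
  proof (cases "true_nat (Exists x \<psi>)")
    case True
    then obtain i where i: "true_nat (f i)"
      by (auto simp: true_nat_Exists f_def)
    have "1 = P (f i)"
      using i inst[of i] by (simp add: f_def)
    also have "\<dots> \<le> P (disj_below (Suc i) f)"
      by (rule prob_mono[OF f D]) (auto simp: PA_valid_def models_def sat_disj_below)
    also have "\<dots> \<le> P (Exists x \<psi>)"
      unfolding sup
      by (rule cSUP_upper) (use prob_range[OF D] in \<open>auto intro!: bdd_aboveI2[where M = 1]\<close>)
    finally show ?thesis
      using True prob_range[OF sent] by auto
  next
    case False
    then have "P (f i) = 0" for i
      using inst[of i] by (simp add: true_nat_Exists f_def)
    then have "P (disj_below n f) = 0" for n
      using prob_disj_below_le[of f n, OF f] prob_range[OF D, of n] by simp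
    then show ?thesis
      using False by (simp add: sup)
  qed
qed

theorem prob_eq_truth: "\<phi> \<in> sentences \<Longrightarrow> P \<phi> = of_bool (true_nat \<phi>)"
proof (induction \<phi> rule: measure_induct_rule[where f = complexity])
  case (less \<phi>)
  note connective = prob_eq_truth_consequence[OF _ _ less.prems]
  show ?case
  proof (cases \<phi>)
    case (Eq s t)
    then show ?thesis
      using prob_valid[OF true_literal_sentence] PA_valid_true_atom prob_eq_truth_iff less.prems
      by blast
  next
    case (Less s t)
    then show ?thesis
      using prob_valid[OF true_literal_sentence] PA_valid_true_atom prob_eq_truth_iff less.prems
      by blast
  next
    case (Neg \<psi>)
    then show ?thesis
      using less prob_Neg[of \<psi>] by (simp add: sentences_def true_nat_simps of_bool_def)
  next
    case (And \<psi> \<chi>)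
    show ?thesis
      by (rule connective[of \<psi> \<chi>])
        (use And less in \<open>auto simp: sentences_def true_literal_def true_nat_simps
          PA_valid_def models_def\<close>)
  next
    case (Or \<psi> \<chi>)
    show ?thesis
      by (rule connective[of \<psi> \<chi>])
        (use Or less in \<open>auto simp: sentences_def true_literal_def true_nat_simps
          PA_valid_def models_def\<close>)
  next
    case (Imp \<psi> \<chi>)
    show ?thesis
      by (rule connective[of \<psi> \<chi>])
        (use Imp less in \<open>auto simp: sentences_def true_literal_def true_nat_simps
          PA_valid_def models_def\<close>)
  next
    case (Exists x \<psi>)
    have "P (subst \<psi> x (numeral_tm i)) = of_bool (true_nat (subst \<psi> x (numeral_tm i)))" for i
      using Exists less instance_sentence by (simp add: complexity_subst)
    then show ?thesis
      using prob_Exists_eq_truth less.prems by (simp add: Exists)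
  next
    case (Forall x \<psi>)
    have ex: "Exists x (Neg \<psi>) \<in> sentences" "Exists x \<psi> \<in> sentences"
      using less.prems Forall by (auto simp: sentences_def)
    have "P (subst \<psi> x (numeral_tm i)) = of_bool (true_nat (subst \<psi> x (numeral_tm i)))" for i
      using Forall less.IH instance_sentence[OF ex(2)] by (simp add: complexity_subst)
    then have inst: "P (subst (Neg \<psi>) x (numeral_tm i)) =
        of_bool (true_nat (subst (Neg \<psi>) x (numeral_tm i)))" for i
      using prob_Neg[OF instance_sentence[OF ex(2)], of i]
      by (simp add: true_nat_simps of_bool_def)
    have ex_eq: "P (Exists x (Neg \<psi>)) = of_bool (true_nat (Exists x (Neg \<psi>)))"
      by (rule prob_Exists_eq_truth[OF ex(1) inst])
    \<comment> \<open>A consequence of a single premise, used twice to fit the rule with two premises.\<close>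
    show ?thesis
      by (rule connective[OF ex(1) ex(1) ex_eq ex_eq])
        (auto simp: Forall true_literal_def true_nat_Forall PA_valid_def models_def)
  qed
qed

end

theorem theorem3:
  fixes P :: "fm \<Rightarrow> real"
  assumes range: "\<And>\<phi>. \<phi> \<in> sentences \<Longrightarrow> P \<phi> \<in> {0..1}"
    and valid: "\<And>\<phi>. \<phi> \<in> sentences \<Longrightarrow> PA_valid TYPE('u) \<phi> \<Longrightarrow> P \<phi> = 1"
    and additive: "\<And>\<phi> \<psi>. \<phi> \<in> sentences \<Longrightarrow> \<psi> \<in> sentences \<Longrightarrow>
      PA_valid TYPE('u) (Neg (And \<phi> \<psi>)) \<Longrightarrow> P (Or \<phi> \<psi>) = P \<phi> + P \<psi>"
    and Gaifman: "\<And>x \<psi>. Exists x \<psi> \<in> sentences \<Longrightarrow>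
      P (Exists x \<psi>) = (SUP n. P (disj_below n (\<lambda>i. subst \<psi> x (numeral_tm i))))"
  shows "\<forall>\<phi>\<in>sentences. P \<phi> = truth_value standard_model \<phi>"
proof -
  interpret Gaifman_probability "TYPE('u)" P
    by unfold_locales (fact range valid additive Gaifman)+
  show ?thesis
    by (simp add: prob_eq_truth truth_value_sentence)
qed

end
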